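(* Let $l\ge 0$ be an integer and let $\boldsymbol{\alpha}=(a_0,a_1,\dots)$ be a sequence with $a_k\in\{0,1\}=\mathbb{F}_2$, viewed as a row of the Proth–Gilbreath triangle, with $\phi(\boldsymbol{\alpha})=\sum_{k\ge0}a_kX^k\in\mathbb{F}_2[[X]]$. Then $\boldsymbol{\alpha}$ is ultimately replicated identically in the $l$-th row that follows $\boldsymbol{\alpha}$, namely $\Psi^{[l]}(\boldsymbol{\alpha})$, if and only if there exist an integer $r\ge 0$ and a polynomial $P_l(X)\in\mathbb{F}_2[X]$ such that $$\phi(\boldsymbol{\alpha})=\frac{P_l(X)}{(1+X)^l+X^r}\qquad\text{or}\qquad \phi(\boldsymbol{\alpha})=\frac{P_l(X)}{X^r(1+X)^l+1}.$$
   Context: $\Psi$ is the Proth–Gilbreath operator $(a_0,a_1,\dots)\mapsto(|a_1-a_0|,|a_2-a_1|,\dots)$ (for $0/1$ entries this is $(a_0+a_1,a_1+a_2,\dots)$ in $\mathbb{F}_2$), and $\Psi^{[l]}$ is its $l$-fold iterate ($\Psi^{[0]}$ the identity). A row $\boldsymbol{\beta}=(b_0,b_1,\dots)$ is "ultimately replicated identically" in a row $\boldsymbol{\gamma}=(c_0,c_1,\dots)$ if there exist integers $m,n\ge 0$ such that $b_{m+k}=c_{n+k}$ for all $k\ge 0$. An equality $\phi=P/D$ with $P,D\in\mathbb{F}_2[X]$ means $D(X)\phi=P(X)$ in $\mathbb{F}_2[[X]]$. *)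

theory Defs
  imports "HOL-Library.Z2" "HOL-Computational_Algebra.Polynomial_FPS"
begin

definition proth_gilbreath :: "(nat \<Rightarrow> int) \<Rightarrow> (nat \<Rightarrow> int)"  ("\<Psi>") where
  "\<Psi> a = (\<lambda>k. \<bar>a (Suc k) - a k\<bar>)"

definition ultimately_replicated :: "(nat \<Rightarrow> 'a) \<Rightarrow> (nat \<Rightarrow> 'a) \<Rightarrow> bool" where
  "ultimately_replicated b c \<longleftrightarrow> (\<exists>m n. \<forall>k. b (m + k) = c (n + k))"

text \<open>The type \<open>bit\<close> is the field with two elements; \<open>of_int\<close> is reduction modulo 2,
  which on entries 0 and 1 is the identification of \<open>{0, 1}\<close> with that field.\<close>

definition row_fps :: "(nat \<Rightarrow> int) \<Rightarrow> bit fps"  ("\<phi>") where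
  "\<phi> a = Abs_fps (\<lambda>k. of_int (a k))"

text \<open>The equation \<open>f = P / D\<close> is understood as \<open>D f = P\<close>.  The denominator may vanish:
  \<open>(1 + X) ^ l + X ^ r = 0\<close> for \<open>l = r = 0\<close>.\<close>

definition fps_eq_quotient :: "bit fps \<Rightarrow> bit poly \<Rightarrow> bit poly \<Rightarrow> bool" where
  "fps_eq_quotient f P D \<longleftrightarrow> fps_of_poly D * f = fps_of_poly P"

end

theory Submission
  imports Defs
begin

text \<open>
  Work modulo polynomials, i.e. modulo the subring of power series with finitely many nonzero
  coefficients. Then \<open>X ^ l \<phi>(\<Psi> ^^ l \<alpha>)\<close> is congruent to \<open>(1 + X) ^ l \<phi>(\<alpha>)\<close>, while
  \<open>\<alpha>\<close> is replicated in \<open>\<Psi> ^^ l \<alpha>\<close> iff \<open>X ^ n \<phi>(\<alpha>)\<close> and \<open>X ^ m \<phi>(\<Psi> ^^ l \<alpha>)\<close> are congruent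
  for some \<open>m\<close> and \<open>n\<close>. Hence replication means that \<open>(X ^ (n + l) + X ^ m (1 + X) ^ l) \<phi>(\<alpha>)\<close> is
  a polynomial for some \<open>m\<close> and \<open>n\<close>. A power of \<open>X\<close> can be cancelled here, and the two denominators
  correspond to \<open>m \<le> n + l\<close> and \<open>m \<ge> n + l\<close>.
\<close>

lemma fps_in_range_fps_of_poly_iff:
  "f \<in> range fps_of_poly \<longleftrightarrow> (\<exists>N. \<forall>k\<ge>N. fps_nth f k = 0)"
proof
  assume "f \<in> range fps_of_poly"
  then obtain p where "f = fps_of_poly p" by blast
  then have "\<forall>k\<ge>Suc (degree p). fps_nth f k = 0"
    by (simp add: coeff_eq_0)
  then show "\<exists>N. \<forall>k\<ge>N. fps_nth f k = 0" by blast
next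
  assume "\<exists>N. \<forall>k\<ge>N. fps_nth f k = 0"
  then have "\<forall>\<^sub>\<infinity>k. fps_nth f k = 0"
    by (simp add: cofinite_eq_sequentially eventually_sequentially)
  then have "f = fps_of_poly (Abs_poly (fps_nth f))"
    by (intro fps_ext) (simp add: Abs_poly_inverse)
  then show "f \<in> range fps_of_poly" by blast
qed

lemma range_fps_of_poly_add:
  fixes f g :: "'a :: comm_ring_1 fps"
  shows "f \<in> range fps_of_poly \<Longrightarrow> g \<in> range fps_of_poly \<Longrightarrow> f + g \<in> range fps_of_poly"
  by (auto simp flip: fps_of_poly_add)

lemma range_fps_of_poly_diff:
  fixes f g :: "'a :: comm_ring_1 fps"
  shows "f \<in> range fps_of_poly \<Longrightarrow> g \<in> range fps_of_poly \<Longrightarrow> f - g \<in> range fps_of_poly"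
  by (auto simp flip: fps_of_poly_diff)

lemma range_fps_of_poly_mult:
  fixes f g :: "'a :: comm_ring_1 fps"
  shows "f \<in> range fps_of_poly \<Longrightarrow> g \<in> range fps_of_poly \<Longrightarrow> f * g \<in> range fps_of_poly"
  by (auto simp flip: fps_of_poly_mult)

lemma range_fps_of_poly_cong:
  fixes f g :: "'a :: comm_ring_1 fps"
  assumes "f - g \<in> range fps_of_poly"
  shows "f \<in> range fps_of_poly \<longleftrightarrow> g \<in> range fps_of_poly"
  using range_fps_of_poly_diff[of f "f - g"] range_fps_of_poly_add[of "f - g" g] assms by auto

text \<open>Multiplication by \<open>fps_X ^ n\<close> only shifts coefficients, so it does not
  affect whether they eventually vanish. Modulo polynomials, \<open>fps_X\<close> can thus be
  cancelled.\<close>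

lemma fps_X_power_mult_in_range_fps_of_poly_iff:
  fixes f :: "'a :: comm_ring_1 fps"
  shows "fps_X ^ n * f \<in> range fps_of_poly \<longleftrightarrow> f \<in> range fps_of_poly"
proof
  assume "fps_X ^ n * f \<in> range fps_of_poly"
  then obtain N where N: "\<And>k. k \<ge> N \<Longrightarrow> fps_nth (fps_X ^ n * f) k = 0"
    unfolding fps_in_range_fps_of_poly_iff by blast
  have "fps_nth f k = 0" if "k \<ge> N" for k
    using N[of "k + n"] that by (simp add: fps_X_power_mult_nth)
  then show "f \<in> range fps_of_poly"
    unfolding fps_in_range_fps_of_poly_iff by blast
next
  assume "f \<in> range fps_of_poly"
  moreover have "fps_X ^ n \<in> range (fps_of_poly :: 'a poly \<Rightarrow> _)"
    by (metis fps_of_poly_monom' rangeI)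
  ultimately show "fps_X ^ n * f \<in> range fps_of_poly"
    by (intro range_fps_of_poly_mult)
qed

text \<open>The exponents are crossed: the shifts by \<open>n\<close> and \<open>m\<close> bring
  coefficient \<open>m + k\<close> of \<open>f\<close> and coefficient \<open>n + k\<close> of
  \<open>g\<close> to the common position \<open>m + n + k\<close>.\<close>

lemma ultimately_replicated_iff_fps:
  fixes f g :: "'a :: comm_ring_1 fps"
  shows "ultimately_replicated (fps_nth f) (fps_nth g) \<longleftrightarrow>
    (\<exists>m n. fps_X ^ n * f - fps_X ^ m * g \<in> range fps_of_poly)"
proof
  assume "ultimately_replicated (fps_nth f) (fps_nth g)"
  then obtain m n where mn: "\<And>k. fps_nth f (m + k) = fps_nth g (n + k)"
    unfolding ultimately_replicated_def by blast
  have "fps_nth (fps_X ^ n * f - fps_X ^ m * g) k = 0" if "k \<ge> m + n" for k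
    using that mn[of "k - (m + n)"] by (simp add: fps_X_power_mult_nth)
  then show "\<exists>m n. fps_X ^ n * f - fps_X ^ m * g \<in> range fps_of_poly"
    unfolding fps_in_range_fps_of_poly_iff by blast
next
  assume "\<exists>m n. fps_X ^ n * f - fps_X ^ m * g \<in> range fps_of_poly"
  then obtain m n N where N: "\<And>k. k \<ge> N \<Longrightarrow> fps_nth (fps_X ^ n * f - fps_X ^ m * g) k = 0"
    unfolding fps_in_range_fps_of_poly_iff by blast
  \<comment> \<open>The coefficients are known to agree only from position \<open>N\<close> on, so
    both offsets are enlarged by \<open>N\<close>.\<close>
  have "fps_nth f (N + m + k) = fps_nth g (N + n + k)" for k
    using N[of "N + m + n + k"] by (simp add: fps_X_power_mult_nth add_ac)
  then show "ultimately_replicated (fps_nth f) (fps_nth g)"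
    unfolding ultimately_replicated_def by blast
qed

lemma bit_fps_diff_eq_add: "f - g = f + g" for f g :: "bit fps"
  by (intro fps_ext) simp

text \<open>Signs vanish modulo 2, which makes \<open>\<Psi>\<close> additive there.\<close>

lemma of_int_abs_bit: "of_int \<bar>x\<bar> = (of_int x :: bit)"
  by (simp add: abs_if)

text \<open>In degree \<open>k + 1\<close> both products have coefficient
  \<open>a (k + 1) + a k\<close> modulo 2; only the constant terms can differ.\<close>

lemma fps_X_mult_row_fps_proth_gilbreath:
  "fps_X * \<phi> (\<Psi> a) - (1 + fps_X) * \<phi> a \<in> range fps_of_poly"
proof -
  have "fps_nth (fps_X * \<phi> (\<Psi> a) - (1 + fps_X) * \<phi> a) k = 0" if "k \<ge> 1" for k
    using that
    by (cases k) (simp_all add: row_fps_def proth_gilbreath_def of_int_abs_bit ring_distribs)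
  then show ?thesis
    unfolding fps_in_range_fps_of_poly_iff by blast
qed

lemma fps_one_plus_X_in_range_fps_of_poly:
  "1 + fps_X \<in> range (fps_of_poly :: bit poly \<Rightarrow> _)"
  by (rule range_eqI[of _ _ "[:1, 1:]"]) (simp add: fps_of_poly_pCons)

lemma fps_X_power_mult_row_fps_proth_gilbreath:
  "fps_X ^ l * \<phi> ((\<Psi> ^^ l) a) - (1 + fps_X) ^ l * \<phi> a \<in> range fps_of_poly"
proof (induction l)
  case 0
  show ?case by (auto intro: range_eqI[of _ _ 0])
next
  case (Suc l)
  let ?b = "(\<Psi> ^^ l) a"
  \<comment> \<open>The term \<open>fps_X ^ l * (1 + fps_X) * \<phi> ?b\<close> is inserted, which
    separates the one-step congruence for row \<open>?b\<close> from the induction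
    hypothesis.\<close>
  have "fps_X ^ Suc l * \<phi> ((\<Psi> ^^ Suc l) a) - (1 + fps_X) ^ Suc l * \<phi> a =
      fps_X ^ l * (fps_X * \<phi> (\<Psi> ?b) - (1 + fps_X) * \<phi> ?b) +
      (1 + fps_X) * (fps_X ^ l * \<phi> ?b - (1 + fps_X) ^ l * \<phi> a)"
    by (simp add: algebra_simps)
  also have "\<dots> \<in> range fps_of_poly"
    by (intro range_fps_of_poly_add range_fps_of_poly_mult[OF fps_one_plus_X_in_range_fps_of_poly]
        Suc.IH)
      (simp add: fps_X_power_mult_in_range_fps_of_poly_iff fps_X_mult_row_fps_proth_gilbreath)
  finally show ?case .
qed

lemma proth_gilbreath_power_binary:
  assumes "\<And>k. a k \<in> {0, 1}"
  shows "(\<Psi> ^^ l) a k \<in> {0, 1}"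
proof (induction l arbitrary: k)
  case 0
  show ?case using assms by simp
next
  case (Suc l)
  show ?case using Suc.IH[of k] Suc.IH[of "Suc k"] by (auto simp: proth_gilbreath_def)
qed

text \<open>Replication compares integers, while \<open>\<phi>\<close> retains only residues;
  reduction modulo 2 is injective on 0 and 1.\<close>

lemma ultimately_replicated_iff_row_fps:
  assumes "\<And>k. a k \<in> {0, 1}" and "\<And>k. b k \<in> {0, 1}"
  shows "ultimately_replicated a b \<longleftrightarrow>
    ultimately_replicated (fps_nth (\<phi> a)) (fps_nth (\<phi> b))"
proof -
  have "a i = b j \<longleftrightarrow> fps_nth (\<phi> a) i = fps_nth (\<phi> b) j" for i j
    using assms(1)[of i] assms(2)[of j] by (auto simp: row_fps_def)
  then show ?thesis by (simp add: ultimately_replicated_def)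
qed

lemma row_fps_replication_iff:
  "fps_X ^ n * \<phi> a - fps_X ^ m * \<phi> ((\<Psi> ^^ l) a) \<in> range fps_of_poly \<longleftrightarrow>
    (fps_X ^ m * (1 + fps_X) ^ l + fps_X ^ (n + l)) * \<phi> a \<in> range fps_of_poly"
proof -
  let ?g = "\<phi> ((\<Psi> ^^ l) a)"
  \<comment> \<open>Multiplying by \<open>fps_X ^ l\<close> makes the congruence for
    \<open>fps_X ^ l * ?g\<close> applicable. This identity holds in any commutative ring;
    characteristic 2 then adjusts the signs.\<close>
  have "fps_X ^ l * (fps_X ^ n * \<phi> a - fps_X ^ m * ?g) +
      (fps_X ^ m * (1 + fps_X) ^ l - fps_X ^ (n + l)) * \<phi> a =
      - (fps_X ^ m * (fps_X ^ l * ?g - (1 + fps_X) ^ l * \<phi> a))"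
    by (simp add: algebra_simps power_add)
  also have "\<dots> = 0 - fps_X ^ m * (fps_X ^ l * ?g - (1 + fps_X) ^ l * \<phi> a)"
    by simp
  also have "\<dots> \<in> range fps_of_poly"
  proof (rule range_fps_of_poly_diff)
    show "0 \<in> range (fps_of_poly :: bit poly \<Rightarrow> _)"
      by (rule range_eqI[of _ _ 0]) simp
    show "fps_X ^ m * (fps_X ^ l * ?g - (1 + fps_X) ^ l * \<phi> a) \<in> range fps_of_poly"
      unfolding fps_X_power_mult_in_range_fps_of_poly_iff
      by (rule fps_X_power_mult_row_fps_proth_gilbreath)
  qed
  finally have "fps_X ^ l * (fps_X ^ n * \<phi> a - fps_X ^ m * ?g) -
      (fps_X ^ m * (1 + fps_X) ^ l + fps_X ^ (n + l)) * \<phi> a \<in> range fps_of_poly"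
    by (simp only: bit_fps_diff_eq_add)
  from range_fps_of_poly_cong[OF this] show ?thesis
    by (simp only: fps_X_power_mult_in_range_fps_of_poly_iff)
qed

lemma ex_fps_eq_quotient_iff:
  "(\<exists>P. fps_eq_quotient f P D) \<longleftrightarrow> fps_of_poly D * f \<in> range fps_of_poly"
  by (auto simp: fps_eq_quotient_def)

theorem theorem6:
  fixes l :: nat and \<alpha> :: "nat \<Rightarrow> int"
  assumes "\<And>k. \<alpha> k \<in> {0, 1}"
  shows "ultimately_replicated \<alpha> ((\<Psi> ^^ l) \<alpha>) \<longleftrightarrow>
    (\<exists>(r :: nat) (P :: bit poly).
       fps_eq_quotient (\<phi> \<alpha>) P ([:1, 1:] ^ l + [:0, 1:] ^ r) \<or>
       fps_eq_quotient (\<phi> \<alpha>) P ([:0, 1:] ^ r * [:1, 1:] ^ l + 1))"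
proof -
  define R where "R = range (fps_of_poly :: bit poly \<Rightarrow> _)"
  define Y :: "bit fps" where "Y = (1 + fps_X) ^ l"
  have X: "fps_of_poly [:0, 1:] = (fps_X :: bit fps)"
    and X1: "fps_of_poly [:1, 1:] = (1 + fps_X :: bit fps)"
    by (simp_all add: fps_of_poly_pCons)
  have "(\<exists>m n. (fps_X ^ m * Y + fps_X ^ (n + l)) * \<phi> \<alpha> \<in> R) \<longleftrightarrow>
    (\<exists>r. (Y + fps_X ^ r) * \<phi> \<alpha> \<in> R \<or> (fps_X ^ r * Y + 1) * \<phi> \<alpha> \<in> R)"
    (is "?L \<longleftrightarrow> ?R")
  proof
    assume ?L
    then obtain m n where mn: "(fps_X ^ m * Y + fps_X ^ (n + l)) * \<phi> \<alpha> \<in> R" by blast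
    show ?R
    \<comment> \<open>The smaller of the two powers of \<open>fps_X\<close> is factored out and
      cancelled; \<open>r\<close> is the difference of the exponents.\<close>
    proof (cases "m \<le> n + l")
      case True
      then obtain r where r: "n + l = m + r" using le_Suc_ex by blast
      have "(fps_X ^ m * Y + fps_X ^ (n + l)) * \<phi> \<alpha> = fps_X ^ m * ((Y + fps_X ^ r) * \<phi> \<alpha>)"
        unfolding r by (simp add: algebra_simps power_add)
      with mn show ?thesis
        unfolding R_def by (metis fps_X_power_mult_in_range_fps_of_poly_iff)
    next
      case False
      then obtain r where r: "m = (n + l) + r" using le_Suc_ex nat_le_linear by blast
      have "(fps_X ^ m * Y + fps_X ^ (n + l)) * \<phi> \<alpha> =
          fps_X ^ (n + l) * ((fps_X ^ r * Y + 1) * \<phi> \<alpha>)"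
        unfolding r by (simp add: algebra_simps power_add)
      with mn show ?thesis
        unfolding R_def by (metis fps_X_power_mult_in_range_fps_of_poly_iff)
    qed
  next
    assume ?R
    then obtain r where "(Y + fps_X ^ r) * \<phi> \<alpha> \<in> R \<or> (fps_X ^ r * Y + 1) * \<phi> \<alpha> \<in> R" ..
    \<comment> \<open>The pure power in \<open>?L\<close> has exponent at least \<open>l\<close>,
      which \<open>r\<close> or 0 need not reach. After multiplication by \<open>fps_X ^ l\<close>
      the pairs \<open>(m, n)\<close> are \<open>(l, r)\<close> and
      \<open>(l + r, 0)\<close>.\<close>
    then have "fps_X ^ l * ((Y + fps_X ^ r) * \<phi> \<alpha>) \<in> R \<or>
        fps_X ^ l * ((fps_X ^ r * Y + 1) * \<phi> \<alpha>) \<in> R"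
      unfolding R_def fps_X_power_mult_in_range_fps_of_poly_iff .
    moreover have "fps_X ^ l * ((Y + fps_X ^ r) * \<phi> \<alpha>) =
        (fps_X ^ l * Y + fps_X ^ (r + l)) * \<phi> \<alpha>"
      and "fps_X ^ l * ((fps_X ^ r * Y + 1) * \<phi> \<alpha>) =
        (fps_X ^ (l + r) * Y + fps_X ^ (0 + l)) * \<phi> \<alpha>"
      by (simp_all add: algebra_simps power_add)
    ultimately show ?L by metis
  qed
  then show ?thesis
    unfolding ultimately_replicated_iff_row_fps[OF assms proth_gilbreath_power_binary[OF assms]]
      ultimately_replicated_iff_fps row_fps_replication_iff ex_disj_distrib ex_fps_eq_quotient_iff
      fps_of_poly_add fps_of_poly_mult fps_of_poly_power fps_of_poly_1 X X1 R_def Y_def .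
qed

end
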